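(* Let $G$ be a simple connected graph. Then $G$ has exactly two main signless Laplacian eigenvalues if and only if $G$ is a 2-walk $(a,b)$-parabolic graph (for some $a,b$).
   Context: For a graph $G$ with adjacency matrix $A$ and diagonal degree matrix $D$, the signless Laplacian is $Q=D+A$; an eigenvalue of $Q$ is a main signless Laplacian eigenvalue if its eigenspace is not orthogonal to the all-ones vector. For a vertex $v$, $d(v)$ is its degree and $s(v)=\sum_{u\in N_G(v)}d(u)$ is the sum of the degrees of its neighbours. $G$ is called 2-walk $(a,b)$-parabolic if there is exactly one pair $(a,b)$ with $a$ a positive integer and $b$ a non-negative integer satisfying $a^2-8b>0$ such that $s(v)=-d(v)^2+a\,d(v)-b$ holds for every vertex $v\in V(G)$. *)

theory Defs
  imports "Graph_Theory.Graph_Theory" "Jordan_Normal_Form.Char_Poly"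
begin

text \<open>
  Simple undirected graphs are rendered by the locale \<^locale>\<open>graph\<close>: finite, loop-free
  digraphs without multiple arcs whose arc relation is symmetric. An edge \<open>uv\<close> is thus a pair
  of opposite arcs, so that \<^const>\<open>out_degree\<close> is the usual vertex degree.
  Matrices are indexed by \<open>{0..<n}\<close>; a list \<open>vs\<close> enumerating the vertices fixes which vertex
  belongs to which index.
\<close>

definition vertex_enum :: "('a, 'b) pre_digraph \<Rightarrow> 'a list \<Rightarrow> bool" where
  "vertex_enum G vs \<longleftrightarrow> distinct vs \<and> set vs = verts G"

definition adjacency_mat :: "('a, 'b) pre_digraph \<Rightarrow> 'a list \<Rightarrow> real mat" where
  "adjacency_mat G vs =
     mat (length vs) (length vs) (\<lambda>(i, j). if vs ! i \<rightarrow>\<^bsub>G\<^esub> vs ! j then 1 else 0)"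

definition degree_mat :: "('a, 'b) pre_digraph \<Rightarrow> 'a list \<Rightarrow> real mat" where
  "degree_mat G vs = mat_diag (length vs) (\<lambda>i. real (out_degree G (vs ! i)))"

definition signless_laplacian :: "('a, 'b) pre_digraph \<Rightarrow> 'a list \<Rightarrow> real mat" where
  "signless_laplacian G vs = degree_mat G vs + adjacency_mat G vs"

definition eigenspace :: "real mat \<Rightarrow> real \<Rightarrow> real vec set" where
  "eigenspace M \<mu> = {x \<in> carrier_vec (dim_row M). M *\<^sub>v x = \<mu> \<cdot>\<^sub>v x}"

definition all_ones :: "nat \<Rightarrow> real vec" where
  "all_ones n = vec n (\<lambda>_. 1)"

definition main_eigenvalue :: "real mat \<Rightarrow> real \<Rightarrow> bool" where
  "main_eigenvalue M \<mu> \<longleftrightarrow>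
     eigenvalue M \<mu> \<and> \<not> (\<forall>x \<in> eigenspace M \<mu>. x \<bullet> all_ones (dim_row M) = 0)"

definition neighbour_degree_sum :: "('a, 'b) pre_digraph \<Rightarrow> 'a \<Rightarrow> nat" where
  "neighbour_degree_sum G v = (\<Sum>u \<in> {u. v \<rightarrow>\<^bsub>G\<^esub> u}. out_degree G u)"

definition parabolic_pair :: "('a, 'b) pre_digraph \<Rightarrow> int \<Rightarrow> int \<Rightarrow> bool" where
  "parabolic_pair G a b \<longleftrightarrow> a > 0 \<and> b \<ge> 0 \<and> a\<^sup>2 - 8 * b > 0 \<and>
     (\<forall>v \<in> verts G. int (neighbour_degree_sum G v) =
        - (int (out_degree G v))\<^sup>2 + a * int (out_degree G v) - b)"

definition two_walk_parabolic :: "('a, 'b) pre_digraph \<Rightarrow> int \<Rightarrow> int \<Rightarrow> bool" where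
  "two_walk_parabolic G a b \<longleftrightarrow>
     parabolic_pair G a b \<and> (\<forall>a' b'. parabolic_pair G a' b' \<longrightarrow> a' = a \<and> b' = b)"

end

theory Submission
  imports Defs "Jordan_Normal_Form.Schur_Decomposition"
begin

text \<open>
  Write \<open>e\<close> for the all-ones vector. Then \<open>Q e = 2 d\<close> and \<open>Q\<^sup>2 e = 2 (d\<^sup>2 + s)\<close>, so the parabola
  \<open>s = - d\<^sup>2 + a d - b\<close> is the relation \<open>Q\<^sup>2 e = a Q e - 2 b e\<close>. Since \<open>Q\<close> is symmetric, \<open>e\<close> is the
  sum of its projections to the main eigenspaces, and the main eigenvalues are the roots \<open>p, q\<close> of
  \<open>t\<^sup>2 - a t + 2 b\<close> unless \<open>e\<close> is itself an eigenvector, that is, unless \<open>G\<close> is regular; for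
  regular graphs the parabola is never unique. Conversely, \<open>a = p + q\<close> and \<open>2 b = p q\<close> have the
  right signs because \<open>Q\<close> is positive semidefinite, \<open>a\<close> is an integer because all \<open>Q\<^sup>k e\<close> are
  integral, and then \<open>b = a d - d\<^sup>2 - s\<close> is an integer too.
\<close>

section \<open>Symmetric real matrices have enough eigenvectors\<close>

lemma minus_vec_eq_0_iff:
  fixes u v :: "'a :: ab_group_add vec"
  assumes "u \<in> carrier_vec n" "v \<in> carrier_vec n"
  shows "u - v = 0\<^sub>v n \<longleftrightarrow> u = v"
  using assms by (auto simp: vec_eq_iff)

text \<open>Induction on the support of \<open>w\<close> in the triangularising basis: \<open>A - B\<^sub>k\<^sub>k\<close> shrinks it.\<close>

lemma invariant_subspace_eq_0:
  fixes A :: "'a :: field mat"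
  assumes A: "A \<in> carrier_mat n n" and sim: "similar_mat_wit A B P Q" and B: "upper_triangular B"
    and W: "W \<subseteq> carrier_vec n"
    and inv: "\<And>w z. w \<in> W \<Longrightarrow> A *\<^sub>v w - z \<cdot>\<^sub>v w \<in> W"
    and noeig: "\<And>w z. w \<in> W \<Longrightarrow> A *\<^sub>v w = z \<cdot>\<^sub>v w \<Longrightarrow> w = 0\<^sub>v n"
    and w: "w \<in> W"
  shows "w = 0\<^sub>v n"
proof -
  note D = similar_mat_witD2[OF A sim]
  \<comment> \<open>\<open>Q *\<^sub>v w\<close> lists the coordinates of \<open>w\<close> in the
    basis of columns of \<open>P\<close>. At \<open>k = n\<close> the vanishing condition is empty,
    so all of \<open>W\<close> is covered.\<close>
  have "\<forall>w\<in>W. (\<forall>i. k \<le> i \<longrightarrow> i < n \<longrightarrow> (Q *\<^sub>v w) $ i = 0) \<longrightarrow> w = 0\<^sub>v n" if "k \<le> n" for k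
    using that
  proof (induction k)
    case 0
    show ?case
    proof (intro ballI impI)
      fix w assume w: "w \<in> W" and *: "\<forall>i. 0 \<le> i \<longrightarrow> i < n \<longrightarrow> (Q *\<^sub>v w) $ i = 0"
      have wc: "w \<in> carrier_vec n" using w W by auto
      have "Q *\<^sub>v w = 0\<^sub>v n" using * D by (intro eq_vecI) auto
      then have "P *\<^sub>v (Q *\<^sub>v w) = 0\<^sub>v n" using D(6) by auto
      then show "w = 0\<^sub>v n"
        using D wc by (metis assoc_mult_mat_vec one_mult_mat_vec)
    qed
  next
    case (Suc k)
    show ?case
    proof (intro ballI impI)
      fix w assume w: "w \<in> W" and *: "\<forall>i. Suc k \<le> i \<longrightarrow> i < n \<longrightarrow> (Q *\<^sub>v w) $ i = 0"
      let ?z = "B $$ (k, k)"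
      let ?w = "A *\<^sub>v w - ?z \<cdot>\<^sub>v w"
      have wc: "w \<in> carrier_vec n" using w W by auto
      have Qw: "Q *\<^sub>v w \<in> carrier_vec n" using D wc by auto
      have "Q *\<^sub>v (A *\<^sub>v w) = B *\<^sub>v (Q *\<^sub>v w)"
      proof -
        have "Q * A = B * Q"
        proof -
          have "Q * A = Q * (P * (B * Q))"
            using D by (simp add: assoc_mult_mat[of _ n n _ n _ n])
          also have "\<dots> = Q * P * (B * Q)"
            using D(5-7) by (intro assoc_mult_mat[symmetric]) auto
          also have "\<dots> = B * Q" using D by simp
          finally show ?thesis .
        qed
        then show ?thesis
          using D(4-7) wc assoc_mult_mat_vec[of Q n n A n w] assoc_mult_mat_vec[of B n n Q n w] by simp
      qed
      then have Qw': "Q *\<^sub>v ?w = B *\<^sub>v (Q *\<^sub>v w) - ?z \<cdot>\<^sub>v (Q *\<^sub>v w)"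
        using A D(7) wc by (simp add: mult_minus_distrib_mat_vec[of Q n n] mult_mat_vec[of Q n n])
      have "(Q *\<^sub>v ?w) $ i = 0" if i: "k \<le> i" "i < n" for i
      proof -
        have "(B *\<^sub>v (Q *\<^sub>v w)) $ i = (\<Sum>j = 0..<n. B $$ (i, j) * (Q *\<^sub>v w) $ j)"
          using D i Qw by (auto simp: scalar_prod_def)
        \<comment> \<open>Row \<open>i \<ge> k\<close> of \<open>B\<close> vanishes left of column
          \<open>k\<close>, and the coordinates of \<open>w\<close> beyond \<open>k\<close> are
          zero, so only \<open>j = k\<close> survives.\<close>
        also have "\<dots> = (\<Sum>j = 0..<n. if j = k then B $$ (i, k) * (Q *\<^sub>v w) $ k else 0)"
        proof (rule sum.cong[OF refl])
          fix j assume j: "j \<in> {0..<n}"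
          consider "j < k" | "j = k" | "k < j" by linarith
          then show "B $$ (i, j) * (Q *\<^sub>v w) $ j = (if j = k then B $$ (i, k) * (Q *\<^sub>v w) $ k else 0)"
          proof cases
            case 1
            then have "B $$ (i, j) = 0" using upper_triangularD[OF B, of j i] i D by auto
            then show ?thesis using 1 by simp
          next
            case 3 then show ?thesis using * j D by auto
          qed simp
        qed
        also have "\<dots> = B $$ (i, k) * (Q *\<^sub>v w) $ k" using Suc.prems by simp
        also have "\<dots> = ?z * (Q *\<^sub>v w) $ i"
        proof (cases "i = k")
          case False
          then have "B $$ (i, k) = 0" using upper_triangularD[OF B, of k i] i D by auto
          moreover have "(Q *\<^sub>v w) $ i = 0" using * i False by auto
          ultimately show ?thesis by (simp del: index_mult_mat_vec)
        qed simp
        finally show ?thesis unfolding Qw' using i D wc by simp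
      qed
      \<comment> \<open>\<open>?w\<close> is zero by induction, which turns \<open>w\<close> into a
        solution of the eigenvector equation for \<open>?z\<close>, and \<open>noeig\<close>
        applies.\<close>
      then have "?w = 0\<^sub>v n" using Suc inv[OF w] by auto
      then have "A *\<^sub>v w = ?z \<cdot>\<^sub>v w"
        using A wc minus_vec_eq_0_iff[of "A *\<^sub>v w" n "?z \<cdot>\<^sub>v w"] by simp
      then show "w = 0\<^sub>v n" by (rule noeig[OF w])
    qed
  qed
  from this[OF order.refl] w show ?thesis by auto
qed

lemma symmetric_scalar_prod:
  fixes A :: "'a :: comm_semiring_0 mat"
  assumes "A \<in> carrier_mat n n" "A\<^sup>T = A" "x \<in> carrier_vec n" "y \<in> carrier_vec n"
  shows "(A *\<^sub>v x) \<bullet> y = x \<bullet> (A *\<^sub>v y)"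
  using assms by (metis transpose_vec_mult_scalar)

text \<open>A real matrix acts separately on real and imaginary parts. This links real eigenvectors
  to the complex setting, where a triangular form always exists.\<close>

lemma Re_Im_mult_mat_vec:
  fixes A :: "real mat"
  assumes "A \<in> carrier_mat n m" "w \<in> carrier_vec m"
  shows "map_vec Re (map_mat complex_of_real A *\<^sub>v w) = A *\<^sub>v map_vec Re w"
    and "map_vec Im (map_mat complex_of_real A *\<^sub>v w) = A *\<^sub>v map_vec Im w"
  using assms by (auto intro!: eq_vecI sum.cong simp: scalar_prod_def)

lemma scalar_prod_self_eq_0:
  fixes x :: "real vec"
  assumes "x \<in> carrier_vec n"
  shows "x \<bullet> x = 0 \<longleftrightarrow> x = 0\<^sub>v n"
  using conjugate_square_eq_0_vec[OF assms] by simp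

lemma scalar_prod_self_ge_0:
  fixes x :: "real vec"
  shows "0 \<le> x \<bullet> x"
  by (auto simp: scalar_prod_def intro: sum_nonneg)

text \<open>The spectral theorem, in the form that the eigenvectors of a symmetric matrix span.\<close>

lemma orthogonal_to_eigenvectors_imp_0:
  fixes A :: "real mat"
  assumes A: "A \<in> carrier_mat n n" and sym: "A\<^sup>T = A" and w: "w \<in> carrier_vec n"
    and orth: "\<And>x \<mu>. x \<in> carrier_vec n \<Longrightarrow> A *\<^sub>v x = \<mu> \<cdot>\<^sub>v x \<Longrightarrow> w \<bullet> x = 0"
  shows "w = 0\<^sub>v n"
proof -
  define C where "C = map_mat complex_of_real A"
  have C: "C \<in> carrier_mat n n" using A by (simp add: C_def)
  obtain es where es: "char_poly C = (\<Prod>a\<leftarrow>es. [:- a, 1:])" using char_poly_factorized[OF C] by auto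
  obtain B P Q where "schur_decomposition C es = (B, P, Q)" by (cases "schur_decomposition C es") auto
  from schur_decomposition[OF C es this]
  have sim: "similar_mat_wit C B P Q" and B: "upper_triangular B" by auto
  \<comment> \<open>\<open>W\<close> is the complexification of the orthogonal complement of the
    real eigenvectors.\<close>
  define W where "W = {y \<in> carrier_vec n. \<forall>x\<in>carrier_vec n. \<forall>\<mu>. A *\<^sub>v x = \<mu> \<cdot>\<^sub>v x \<longrightarrow>
    map_vec Re y \<bullet> x = 0 \<and> map_vec Im y \<bullet> x = 0}"
  note ReIm = Re_Im_mult_mat_vec[OF A, folded C_def]
  have "C *\<^sub>v y - z \<cdot>\<^sub>v y \<in> W" if y: "y \<in> W" for y z
  proof -
    let ?u = "map_vec Re y" and ?v = "map_vec Im y"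
    have yc: "y \<in> carrier_vec n" using y by (auto simp: W_def)
    have Cy: "C *\<^sub>v y \<in> carrier_vec n" using C yc by auto
    have uv: "?u \<in> carrier_vec n" "?v \<in> carrier_vec n" using yc by auto
    have Auv: "A *\<^sub>v ?u \<in> carrier_vec n" "A *\<^sub>v ?v \<in> carrier_vec n" using A uv by auto
    have re: "map_vec Re (C *\<^sub>v y - z \<cdot>\<^sub>v y) = A *\<^sub>v ?u - (Re z \<cdot>\<^sub>v ?u - Im z \<cdot>\<^sub>v ?v)"
      unfolding ReIm(1)[OF yc, symmetric] using Cy yc C by (intro eq_vecI) auto
    have im: "map_vec Im (C *\<^sub>v y - z \<cdot>\<^sub>v y) = A *\<^sub>v ?v - (Re z \<cdot>\<^sub>v ?v + Im z \<cdot>\<^sub>v ?u)"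
      unfolding ReIm(2)[OF yc, symmetric] using Cy yc C by (intro eq_vecI) auto
    have "map_vec Re (C *\<^sub>v y - z \<cdot>\<^sub>v y) \<bullet> x = 0 \<and> map_vec Im (C *\<^sub>v y - z \<cdot>\<^sub>v y) \<bullet> x = 0"
      if x: "x \<in> carrier_vec n" and ev: "A *\<^sub>v x = \<mu> \<cdot>\<^sub>v x" for x \<mu>
    proof -
      have 0: "?u \<bullet> x = 0" "?v \<bullet> x = 0" using y x ev by (auto simp: W_def)
      \<comment> \<open>Symmetry moves \<open>A\<close> onto the eigenvector \<open>x\<close>, where
        it becomes a scalar.\<close>
      have "(A *\<^sub>v ?u) \<bullet> x = 0" "(A *\<^sub>v ?v) \<bullet> x = 0"
        using symmetric_scalar_prod[OF A sym uv(1) x] symmetric_scalar_prod[OF A sym uv(2) x] x uv 0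
        by (auto simp: ev)
      with 0 show ?thesis unfolding re im using uv Auv x
        by (simp add: minus_scalar_prod_distrib[of _ n] add_scalar_prod_distrib[of _ n]
            smult_scalar_prod_distrib[of _ n] del: smult_scalar_prod_distrib)
    qed
    then show ?thesis using Cy yc by (auto simp: W_def)
  qed
  moreover have "y = 0\<^sub>v n" if y: "y \<in> W" and ev: "C *\<^sub>v y = z \<cdot>\<^sub>v y" for y z
  proof -
    let ?u = "map_vec Re y" and ?v = "map_vec Im y"
    have yc: "y \<in> carrier_vec n" using y by (auto simp: W_def)
    have uv: "?u \<in> carrier_vec n" "?v \<in> carrier_vec n" using yc by auto
    have Au: "A *\<^sub>v ?u = Re z \<cdot>\<^sub>v ?u - Im z \<cdot>\<^sub>v ?v"
      unfolding ReIm(1)[OF yc, symmetric] ev using yc by (intro eq_vecI) auto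
    have Av: "A *\<^sub>v ?v = Re z \<cdot>\<^sub>v ?v + Im z \<cdot>\<^sub>v ?u"
      unfolding ReIm(2)[OF yc, symmetric] ev using yc by (intro eq_vecI) auto
    \<comment> \<open>Evaluating both sides gives
      \<open>Im z * (?u \<bullet> ?u + ?v \<bullet> ?v) = 0\<close>, so \<open>z\<close> is real or
      \<open>y\<close> is zero.\<close>
    have "(A *\<^sub>v ?u) \<bullet> ?v = ?u \<bullet> (A *\<^sub>v ?v)" by (rule symmetric_scalar_prod[OF A sym uv])
    then have "Re z * (?u \<bullet> ?v) - Im z * (?v \<bullet> ?v) = Re z * (?u \<bullet> ?v) + Im z * (?u \<bullet> ?u)"
      unfolding Au Av using uv
      by (simp add: minus_scalar_prod_distrib[of _ n] scalar_prod_add_distrib[of _ n])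
    then have "Im z * (?u \<bullet> ?u + ?v \<bullet> ?v) = 0" by (simp add: algebra_simps)
    moreover have ?thesis if "?u \<bullet> ?u = 0" "?v \<bullet> ?v = 0"
    proof -
      have "?u = 0\<^sub>v n" "?v = 0\<^sub>v n" using that scalar_prod_self_eq_0 uv by blast+
      then show ?thesis using yc
        by (intro eq_vecI) (auto simp: complex_eq_iff vec_eq_iff)
    qed
    moreover have ?thesis if z: "Im z = 0"
    proof -
      have "A *\<^sub>v ?u = Re z \<cdot>\<^sub>v ?u" "A *\<^sub>v ?v = Re z \<cdot>\<^sub>v ?v"
        unfolding Au Av z using uv by (auto intro!: eq_vecI)
      \<comment> \<open>Both parts now satisfy the real eigenvector equation, so membership in
        \<open>W\<close> makes each orthogonal to itself.\<close>
      then have "?u \<bullet> ?u = 0" "?v \<bullet> ?v = 0" using y uv unfolding W_def by blast+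
      then show ?thesis by (rule \<open>?u \<bullet> ?u = 0 \<Longrightarrow> ?v \<bullet> ?v = 0 \<Longrightarrow> y = 0\<^sub>v n\<close>)
    qed
    ultimately show ?thesis
      using scalar_prod_self_ge_0[of ?u] scalar_prod_self_ge_0[of ?v]
      by (metis add_nonneg_eq_0_iff mult_eq_0_iff)
  qed
  moreover have "map_vec complex_of_real w \<in> W"
  proof -
    have "map_vec Re (map_vec complex_of_real w) = w" "map_vec Im (map_vec complex_of_real w) = 0\<^sub>v n"
      using w by auto
    then show ?thesis using w orth by (auto simp: W_def)
  qed
  moreover have "W \<subseteq> carrier_vec n" by (auto simp: W_def)
  ultimately have "map_vec complex_of_real w = 0\<^sub>v n"
    using invariant_subspace_eq_0[OF C sim B, of W] by blast
  then show ?thesis using w by (auto simp: vec_eq_iff)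
qed

section \<open>Main eigenvalues and quadratic relations for the all-ones vector\<close>

text \<open>A vector not orthogonal to \<open>all_ones n\<close> is nonzero, so one witness serves
  both conjuncts of \<open>main_eigenvalue\<close>.\<close>

lemma main_eigenvalue_iff:
  assumes "A \<in> carrier_mat n n"
  shows "main_eigenvalue A \<mu> \<longleftrightarrow>
    (\<exists>x\<in>carrier_vec n. A *\<^sub>v x = \<mu> \<cdot>\<^sub>v x \<and> x \<bullet> all_ones n \<noteq> 0)"
proof -
  have "x \<noteq> 0\<^sub>v n" if "x \<bullet> all_ones n \<noteq> 0" for x :: "real vec"
    using that by (auto simp: all_ones_def)
  then show ?thesis using assms
    unfolding main_eigenvalue_def eigenvalue_def eigenvector_def eigenspace_def by auto
qed

lemma all_ones_carrier [simp]: "all_ones n \<in> carrier_vec n"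
  by (simp add: all_ones_def)

lemma dim_all_ones [simp]: "dim_vec (all_ones n) = n"
  by (simp add: all_ones_def)

text \<open>By symmetry each factor \<open>A\<close> can be moved onto the eigenvector
  \<open>x\<close>, where it contributes a factor \<open>\<mu>\<close>.\<close>

lemma scalar_prod_power2_mult_mat_vec:
  fixes A :: "real mat"
  assumes A: "A \<in> carrier_mat n n" "A\<^sup>T = A" and x: "x \<in> carrier_vec n" "A *\<^sub>v x = \<mu> \<cdot>\<^sub>v x"
    and e: "e \<in> carrier_vec n"
  shows "x \<bullet> (A *\<^sub>v e) = \<mu> * (x \<bullet> e)" and "x \<bullet> (A *\<^sub>v (A *\<^sub>v e)) = \<mu>\<^sup>2 * (x \<bullet> e)"
proof -
  have *: "x \<bullet> (A *\<^sub>v y) = \<mu> * (x \<bullet> y)" if "y \<in> carrier_vec n" for y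
    using symmetric_scalar_prod[OF A x(1) that] x that by simp
  show "x \<bullet> (A *\<^sub>v e) = \<mu> * (x \<bullet> e)" using * e by blast
  then show "x \<bullet> (A *\<^sub>v (A *\<^sub>v e)) = \<mu>\<^sup>2 * (x \<bullet> e)"
    using *[of "A *\<^sub>v e"] A e by (simp add: power2_eq_square)
qed

text \<open>The product of \<open>(A - p) (A - q) e\<close> with an eigenvector \<open>x\<close> for
  \<open>\<mu>\<close> is \<open>(\<mu> - p) (\<mu> - q) (x \<bullet> e)\<close>. It vanishes either
  because \<open>\<mu>\<close> is main, hence \<open>p\<close> or \<open>q\<close>, or because
  \<open>x \<bullet> e = 0\<close>; and only the zero vector is orthogonal to all
  eigenvectors.\<close>

lemma quadratic_relation_of_main_eigenvalues:
  assumes A: "A \<in> carrier_mat n n" "A\<^sup>T = A" and main: "{\<mu>. main_eigenvalue A \<mu>} = {p, q}"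
  shows "A *\<^sub>v (A *\<^sub>v all_ones n) = (p + q) \<cdot>\<^sub>v (A *\<^sub>v all_ones n) - (p * q) \<cdot>\<^sub>v all_ones n"
proof -
  let ?e = "all_ones n"
  let ?w = "A *\<^sub>v (A *\<^sub>v ?e) - ((p + q) \<cdot>\<^sub>v (A *\<^sub>v ?e) - (p * q) \<cdot>\<^sub>v ?e)"
  have c: "A *\<^sub>v ?e \<in> carrier_vec n" "A *\<^sub>v (A *\<^sub>v ?e) \<in> carrier_vec n" using A by auto
  have "?w = 0\<^sub>v n"
  proof (rule orthogonal_to_eigenvectors_imp_0[OF A])
    fix x \<mu> assume x: "x \<in> carrier_vec n" "A *\<^sub>v x = \<mu> \<cdot>\<^sub>v x"
    have "x \<bullet> ?e = 0 \<or> \<mu> = p \<or> \<mu> = q"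
      using main main_eigenvalue_iff[OF A(1)] x by blast
    moreover have "?w \<bullet> x = x \<bullet> ?w" using x c by (intro comm_scalar_prod) auto
    moreover have "x \<bullet> ?w = (\<mu> - p) * (\<mu> - q) * (x \<bullet> ?e)"
      using x c
      by (simp add: scalar_prod_minus_distrib[of _ n] scalar_prod_power2_mult_mat_vec[OF A x])
         (simp add: algebra_simps power2_eq_square)
    ultimately show "?w \<bullet> x = 0" by auto
  qed (use c in auto)
  then show ?thesis using c minus_vec_eq_0_iff[OF c(2)] by simp
qed

text \<open>Cancel \<open>x \<bullet> e\<close> in
  \<open>c (x \<bullet> e) = x \<bullet> A e = \<mu> (x \<bullet> e)\<close>. With two main
  eigenvalues \<open>e\<close> therefore cannot be an eigenvector.\<close>

lemma main_eigenvalue_unique: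
  assumes A: "A \<in> carrier_mat n n" "A\<^sup>T = A" and e: "A *\<^sub>v all_ones n = c \<cdot>\<^sub>v all_ones n"
    and "main_eigenvalue A \<mu>"
  shows "\<mu> = c"
proof -
  obtain x where x: "x \<in> carrier_vec n" "A *\<^sub>v x = \<mu> \<cdot>\<^sub>v x" and "x \<bullet> all_ones n \<noteq> 0"
    using assms main_eigenvalue_iff by blast
  then show ?thesis using scalar_prod_power2_mult_mat_vec(1)[OF A x all_ones_carrier] by (simp add: e)
qed

text \<open>The witness is \<open>x = (A - q) e\<close>: it is nonzero by \<open>noneig\<close>, and
  \<open>A - p\<close> annihilates it by \<open>rel\<close>. It is not orthogonal to
  \<open>e\<close> because \<open>x \<bullet> x = (p - q) (x \<bullet> e)\<close>.\<close>

lemma main_eigenvalue_of_quadratic_relation: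
  assumes A: "A \<in> carrier_mat n n" "A\<^sup>T = A"
    and rel: "A *\<^sub>v (A *\<^sub>v all_ones n) = (p + q) \<cdot>\<^sub>v (A *\<^sub>v all_ones n) - (p * q) \<cdot>\<^sub>v all_ones n"
    and noneig: "A *\<^sub>v all_ones n \<noteq> q \<cdot>\<^sub>v all_ones n"
  shows "main_eigenvalue A p"
proof -
  let ?e = "all_ones n"
  define x where "x = A *\<^sub>v ?e - q \<cdot>\<^sub>v ?e"
  have c: "A *\<^sub>v ?e \<in> carrier_vec n" using A by auto
  have x: "x \<in> carrier_vec n" using c by (simp add: x_def)
  have "A *\<^sub>v x = A *\<^sub>v (A *\<^sub>v ?e) - q \<cdot>\<^sub>v (A *\<^sub>v ?e)"
    unfolding x_def using A c by (simp add: mult_minus_distrib_mat_vec[of A n n] mult_mat_vec[of A n n])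
  also have "\<dots> = p \<cdot>\<^sub>v x"
    unfolding rel x_def using A
    by (intro eq_vecI) (auto simp: algebra_simps simp del: index_mult_mat_vec)
  finally have ev: "A *\<^sub>v x = p \<cdot>\<^sub>v x" .
  have "x \<noteq> 0\<^sub>v n"
    using noneig minus_vec_eq_0_iff[OF c, of "q \<cdot>\<^sub>v ?e"] by (simp add: x_def)
  then have "0 \<noteq> x \<bullet> x" using scalar_prod_self_eq_0[OF x] by simp
  also have "x \<bullet> x = x \<bullet> (A *\<^sub>v ?e) - q * (x \<bullet> ?e)"
    using x c by (subst (2) x_def) (simp add: scalar_prod_minus_distrib[of _ n])
  also have "\<dots> = (p - q) * (x \<bullet> ?e)"
    using scalar_prod_power2_mult_mat_vec(1)[OF A x ev all_ones_carrier] by (simp add: algebra_simps)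
  finally have "x \<bullet> ?e \<noteq> 0" by auto
  then show ?thesis using main_eigenvalue_iff[OF A(1)] x ev by blast
qed

text \<open>Pairing \<open>rel\<close> with a witness for \<open>\<mu>\<close> shows that
  \<open>\<mu>\<close> is a root of \<open>(t - p) (t - q)\<close>. The relation is symmetric in
  \<open>p\<close> and \<open>q\<close>, so both are main.\<close>

lemma main_eigenvalues_of_quadratic_relation:
  assumes A: "A \<in> carrier_mat n n" "A\<^sup>T = A"
    and rel: "A *\<^sub>v (A *\<^sub>v all_ones n) = (p + q) \<cdot>\<^sub>v (A *\<^sub>v all_ones n) - (p * q) \<cdot>\<^sub>v all_ones n"
    and noneig: "\<And>c. A *\<^sub>v all_ones n \<noteq> c \<cdot>\<^sub>v all_ones n"
  shows "{\<mu>. main_eigenvalue A \<mu>} = {p, q}"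
proof (intro equalityI subsetI)
  fix \<mu> assume "\<mu> \<in> {\<mu>. main_eigenvalue A \<mu>}"
  then obtain x where x: "x \<in> carrier_vec n" "A *\<^sub>v x = \<mu> \<cdot>\<^sub>v x" and 0: "x \<bullet> all_ones n \<noteq> 0"
    using main_eigenvalue_iff[OF A(1)] by auto
  have "A *\<^sub>v all_ones n \<in> carrier_vec n" using A by auto
  then have "x \<bullet> (A *\<^sub>v (A *\<^sub>v all_ones n)) = ((p + q) * \<mu> - p * q) * (x \<bullet> all_ones n)"
    unfolding rel using x
    by (simp add: scalar_prod_minus_distrib[of _ n] scalar_prod_power2_mult_mat_vec[OF A x] algebra_simps)
  then have "(\<mu> - p) * (\<mu> - q) * (x \<bullet> all_ones n) = 0"
    using scalar_prod_power2_mult_mat_vec(2)[OF A x all_ones_carrier]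
    by (simp add: algebra_simps power2_eq_square)
  then show "\<mu> \<in> {p, q}" using 0 by auto
next
  have rel': "A *\<^sub>v (A *\<^sub>v all_ones n) = (q + p) \<cdot>\<^sub>v (A *\<^sub>v all_ones n) - (q * p) \<cdot>\<^sub>v all_ones n"
    using rel by (simp add: ac_simps)
  fix \<mu> assume "\<mu> \<in> {p, q}"
  then show "\<mu> \<in> {\<mu>. main_eigenvalue A \<mu>}"
    using main_eigenvalue_of_quadratic_relation[OF A rel noneig]
      main_eigenvalue_of_quadratic_relation[OF A rel' noneig] by auto
qed

section \<open>Integrality of a coefficient of a linear recurrence\<close>

text \<open>If \<open>a = p / q\<close> in lowest terms, then \<open>b\<close> has a denominator dividing \<open>q\<close>, so the
  denominator of \<open>D (k + 1) / D 1\<close> is exactly \<open>q ^ k\<close>; being bounded by \<open>D 1\<close>, it forces \<open>q = 1\<close>.\<close>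

lemma linear_recurrence_integral:
  fixes D :: "nat \<Rightarrow> real"
  assumes int: "\<And>k. D k \<in> \<int>" and D0: "D 0 = 0" and D1: "D 1 \<noteq> 0"
    and rec: "\<And>k. D (k + 2) = a * D (k + 1) - b * D k"
    and b: "b = of_int c * a - of_int t"
  shows "a \<in> \<int>"
proof -
  have "a = D 2 / D 1" using rec[of 0] D0 D1 by (simp add: numeral_2_eq_2)
  then have "a \<in> \<rat>" using int Ints_subset_Rats by (metis Rats_divide subsetD)
  then obtain r where r: "a = of_rat r" by (auto elim: Rats_cases)
  obtain p q where pq: "quotient_of r = (p, q)" by force
  have q: "q > 0" and cop: "coprime p q"
    using quotient_of_denom_pos[OF pq] quotient_of_coprime[OF pq] by auto
  have "a = of_int p / of_int q"
    using quotient_of_div[OF pq] by (simp add: r of_rat_divide)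
  then have aq: "of_int q * a = of_int p" using q by simp
  \<comment> \<open>The numerator of \<open>b\<close> over the denominator \<open>q\<close>, from
    \<open>b = c a - t\<close> and \<open>q a = p\<close>.\<close>
  define m where "m = c * p - t * q"
  have bq: "of_int q * b = of_int m" using aq by (simp add: b m_def algebra_simps)
  \<comment> \<open>The recurrence has order two, so the induction carries two consecutive
    numerators \<open>x\<close> and \<open>y\<close>.\<close>
  have step: "\<exists>x y. of_int (q ^ k) * D (k + 1) = D 1 * of_int x \<and>
      of_int (q ^ (k + 1)) * D (k + 2) = D 1 * of_int y \<and> coprime x q \<and> coprime y q" for k
  proof (induction k)
    case 0
    have "of_int q * D 2 = D 1 * of_int p"
      using rec[of 0] D0 aq[symmetric] by (simp add: numeral_2_eq_2)
    then show ?case using cop by (intro exI[of _ 1] exI[of _ p]) (simp add: numeral_2_eq_2)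
  next
    case (Suc k)
    then obtain x y where x: "of_int (q ^ k) * D (k + 1) = D 1 * of_int x"
      and y: "of_int (q ^ (k + 1)) * D (k + 2) = D 1 * of_int y"
      and cxy: "coprime x q" "coprime y q" by blast
    have "of_int (q ^ (k + 2)) * D (k + 3) =
        (of_int q * a) * (of_int (q ^ (k + 1)) * D (k + 2)) - of_int q * (of_int q * b) * (of_int (q ^ k) * D (k + 1))"
    proof -
      have "D (k + 3) = a * D (k + 2) - b * D (k + 1)"
        using rec[of "k + 1"] by (simp add: numeral_3_eq_3)
      then show ?thesis by (simp only:) (simp add: algebra_simps)
    qed
    also have "\<dots> = D 1 * of_int (p * y - q * m * x)"
      unfolding x y aq bq by (simp add: algebra_simps)
    finally have z: "of_int (q ^ (k + 2)) * D (k + 3) = D 1 * of_int (p * y - q * m * x)" .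
    have cop': "coprime (p * y) q" using cop cxy by simp
    \<comment> \<open>Modulo \<open>q\<close> the new numerator is \<open>p * y\<close>, a product
      of units.\<close>
    have "coprime (p * y - q * m * x) q"
    proof (rule coprimeI)
      fix d assume d: "d dvd p * y - q * m * x" "d dvd q"
      then have "d dvd (p * y - q * m * x) + q * m * x" by (intro dvd_add) auto
      then have "d dvd p * y" by simp
      then show "is_unit d" using cop' d(2) coprime_common_divisor by blast
    qed
    then show ?case using y z cxy
      by (intro exI[of _ y] exI[of _ "p * y - q * m * x"]) (simp add: numeral_3_eq_3)
  qed
  obtain N where N: "D 1 = of_int N" using int by (auto elim: Ints_cases)
  then have "N \<noteq> 0" using D1 by auto
  have "q ^ k dvd N" for k
  proof -
    obtain x where x: "of_int (q ^ k) * D (k + 1) = D 1 * of_int x" and cx: "coprime x q"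
      using step by blast
    obtain d where "D (k + 1) = of_int d" using int by (auto elim: Ints_cases)
    with x N have "(of_int (q ^ k * d) :: real) = of_int (N * x)" by simp
    then have "q ^ k * d = N * x" by (simp only: of_int_eq_iff)
    then have "q ^ k dvd N * x" by (metis dvd_triv_left)
    moreover have "coprime (q ^ k) x" using cx by (simp add: coprime_commute)
    ultimately show ?thesis by (simp add: coprime_dvd_mult_left_iff)
  qed
  \<comment> \<open>The exponent is chosen so that \<open>2 ^ n > n\<close> rules out every
    \<open>q \<ge> 2\<close>.\<close>
  then have le: "q ^ nat \<bar>N\<bar> \<le> \<bar>N\<bar>"
    using \<open>N \<noteq> 0\<close> by (metis dvd_abs_iff zdvd_imp_le zero_less_abs_iff)
  have "q = 1"
  proof (rule ccontr)
    assume "q \<noteq> 1"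
    then have "2 ^ nat \<bar>N\<bar> \<le> q ^ nat \<bar>N\<bar>" using q by (intro power_mono) auto
    moreover have "int (nat \<bar>N\<bar>) < 2 ^ nat \<bar>N\<bar>" by (metis of_nat_less_two_power)
    ultimately show False using le by linarith
  qed
  then show ?thesis using aq by simp
qed

section \<open>The signless Laplacian as an operator on vertex functions\<close>

text \<open>Without parallel arcs, \<open>head G\<close> maps the arcs leaving \<open>v\<close>
  bijectively onto its neighbours.\<close>

lemma (in graph) card_neighbours: "card {u. v \<rightarrow>\<^bsub>G\<^esub> u} = out_degree G v"
proof -
  have "bij_betw (head G) (out_arcs G v) {u. v \<rightarrow>\<^bsub>G\<^esub> u}"
    using no_multi_arcs
    by (auto simp: bij_betw_def inj_on_def arcs_ends_conv arc_to_ends_def image_iff)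
  then show ?thesis unfolding out_degree_def by (metis bij_betw_same_card)
qed

text \<open>Translates sums over matrix indices into sums over vertices: \<open>vs\<close>
  enumerates \<open>verts G\<close> bijectively, and non-neighbours contribute zero.\<close>

lemma (in graph) sum_neighbours:
  fixes f :: "'a \<Rightarrow> real"
  assumes "vertex_enum G vs"
  shows "(\<Sum>j = 0..<length vs. (if v \<rightarrow>\<^bsub>G\<^esub> vs ! j then 1 else 0) * f (vs ! j)) = (\<Sum>u | v \<rightarrow>\<^bsub>G\<^esub> u. f u)"
proof -
  have "bij_betw ((!) vs) {0..<length vs} (verts G)"
    using assms unfolding vertex_enum_def by (intro bij_betw_nth) auto
  then have "(\<Sum>j = 0..<length vs. (if v \<rightarrow>\<^bsub>G\<^esub> vs ! j then 1 else 0) * f (vs ! j))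
      = (\<Sum>u\<in>verts G. (if v \<rightarrow>\<^bsub>G\<^esub> u then 1 else 0) * f u)"
    by (rule sum.reindex_bij_betw)
  also have "\<dots> = (\<Sum>u | v \<rightarrow>\<^bsub>G\<^esub> u. f u)"
    by (rule sum.mono_neutral_cong_right) auto
  finally show ?thesis .
qed

lemma signless_laplacian_carrier [simp]: "signless_laplacian G vs \<in> carrier_mat (length vs) (length vs)"
  by (simp add: signless_laplacian_def degree_mat_def adjacency_mat_def mat_diag_def)

lemma dim_signless_laplacian [simp]:
  "dim_row (signless_laplacian G vs) = length vs" "dim_col (signless_laplacian G vs) = length vs"
  using signless_laplacian_carrier[of G vs] by (auto simp del: signless_laplacian_carrier)

lemma index_signless_laplacian:
  assumes "i < length vs" "j < length vs"
  shows "signless_laplacian G vs $$ (i, j) =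
    (if i = j then real (out_degree G (vs ! i)) else 0) + (if vs ! i \<rightarrow>\<^bsub>G\<^esub> vs ! j then 1 else 0)"
  using assms by (simp add: signless_laplacian_def degree_mat_def adjacency_mat_def mat_diag_def)

lemma (in graph) transpose_signless_laplacian: "(signless_laplacian G vs)\<^sup>T = signless_laplacian G vs"
proof -
  have "v \<rightarrow>\<^bsub>G\<^esub> u \<longleftrightarrow> u \<rightarrow>\<^bsub>G\<^esub> v" for u v
    using sym_arcs by (auto simp: symmetric_def sym_def)
  then show ?thesis
    by (intro eq_matI) (auto simp: index_signless_laplacian)
qed

lemma index_signless_laplacian_mult_vec:
  assumes i: "i < length vs" and x: "x \<in> carrier_vec (length vs)"
  shows "(signless_laplacian G vs *\<^sub>v x) $ i = real (out_degree G (vs ! i)) * x $ i +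
    (\<Sum>j = 0..<length vs. (if vs ! i \<rightarrow>\<^bsub>G\<^esub> vs ! j then 1 else 0) * x $ j)"
proof -
  have "(signless_laplacian G vs *\<^sub>v x) $ i = (\<Sum>j = 0..<length vs. signless_laplacian G vs $$ (i, j) * x $ j)"
    using i x by (auto simp: scalar_prod_def)
  also have "\<dots> = (\<Sum>j = 0..<length vs. (if i = j then real (out_degree G (vs ! i)) * x $ i else 0)
      + (if vs ! i \<rightarrow>\<^bsub>G\<^esub> vs ! j then 1 else 0) * x $ j)"
    using i by (intro sum.cong) (auto simp: index_signless_laplacian algebra_simps)
  finally show ?thesis using i by (simp add: sum.distrib)
qed

lemma (in graph) signless_laplacian_mult_vec:
  assumes "vertex_enum G vs"
  shows "signless_laplacian G vs *\<^sub>v vec (length vs) (\<lambda>i. f (vs ! i)) =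
    vec (length vs) (\<lambda>i. real (out_degree G (vs ! i)) * f (vs ! i) + (\<Sum>u | vs ! i \<rightarrow>\<^bsub>G\<^esub> u. f u))"
proof (rule eq_vecI)
  fix i assume "i < dim_vec (vec (length vs)
    (\<lambda>i. real (out_degree G (vs ! i)) * f (vs ! i) + (\<Sum>u | vs ! i \<rightarrow>\<^bsub>G\<^esub> u. f u)))"
  then have i: "i < length vs" by simp
  show "(signless_laplacian G vs *\<^sub>v vec (length vs) (\<lambda>i. f (vs ! i))) $ i =
    vec (length vs) (\<lambda>i. real (out_degree G (vs ! i)) * f (vs ! i) + (\<Sum>u | vs ! i \<rightarrow>\<^bsub>G\<^esub> u. f u)) $ i"
    using i sum_neighbours[OF assms, of "vs ! i" f, symmetric]
    by (simp add: index_signless_laplacian_mult_vec[OF i] del: index_mult_mat_vec)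
qed simp

lemma (in graph) signless_laplacian_all_ones:
  assumes "vertex_enum G vs"
  defines "M \<equiv> signless_laplacian G vs"
  shows "M *\<^sub>v all_ones (length vs) = vec (length vs) (\<lambda>i. 2 * real (out_degree G (vs ! i)))"
    and "M *\<^sub>v (M *\<^sub>v all_ones (length vs)) = vec (length vs)
      (\<lambda>i. 2 * ((real (out_degree G (vs ! i)))\<^sup>2 + real (neighbour_degree_sum G (vs ! i))))"
proof -
  note mult = signless_laplacian_mult_vec[OF assms(1), folded M_def]
  show 1: "M *\<^sub>v all_ones (length vs) = vec (length vs) (\<lambda>i. 2 * real (out_degree G (vs ! i)))"
    using mult[of "\<lambda>_. 1"] by (simp add: all_ones_def card_neighbours)
  show "M *\<^sub>v (M *\<^sub>v all_ones (length vs)) = vec (length vs)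
      (\<lambda>i. 2 * ((real (out_degree G (vs ! i)))\<^sup>2 + real (neighbour_degree_sum G (vs ! i))))"
    unfolding 1 mult[of "\<lambda>v. 2 * real (out_degree G v)"]
    by (simp add: neighbour_degree_sum_def power2_eq_square sum_distrib_left algebra_simps)
qed

text \<open>Twice the quadratic form is the sum of \<open>(x\<^sub>i + x\<^sub>j)\<^sup>2\<close> over the arcs \<open>ij\<close>.\<close>

lemma (in graph) signless_laplacian_psd:
  assumes vs: "vertex_enum G vs" and x: "x \<in> carrier_vec (length vs)"
  shows "0 \<le> x \<bullet> (signless_laplacian G vs *\<^sub>v x)"
proof -
  let ?n = "length vs"
  define a where "a i j = (if vs ! i \<rightarrow>\<^bsub>G\<^esub> vs ! j then 1 else 0 :: real)" for i j
  have sym: "a i j = a j i" for i j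
    using sym_arcs by (auto simp: a_def symmetric_def sym_def)
  have deg: "real (out_degree G (vs ! i)) = (\<Sum>j = 0..<?n. a i j)" for i
    using sum_neighbours[OF vs, of "vs ! i" "\<lambda>_. 1"] by (simp add: a_def card_neighbours)
  have "x \<bullet> (signless_laplacian G vs *\<^sub>v x) =
      (\<Sum>i = 0..<?n. x $ i * (real (out_degree G (vs ! i)) * x $ i + (\<Sum>j = 0..<?n. a i j * x $ j)))"
    using x
    by (auto simp: scalar_prod_def[of x] index_signless_laplacian_mult_vec a_def simp del: index_mult_mat_vec)
  also have "\<dots> = (\<Sum>i = 0..<?n. \<Sum>j = 0..<?n. a i j * ((x $ i)\<^sup>2 + x $ i * x $ j))"
    unfolding deg by (simp add: sum_distrib_left sum_distrib_right sum.distrib algebra_simps power2_eq_square)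
  finally have 1: "x \<bullet> (signless_laplacian G vs *\<^sub>v x) =
    (\<Sum>i = 0..<?n. \<Sum>j = 0..<?n. a i j * ((x $ i)\<^sup>2 + x $ i * x $ j))" .
  \<comment> \<open>Exchanging the roles of \<open>i\<close> and \<open>j\<close> is allowed since
    \<open>a\<close> is symmetric. Adding the two forms completes the square.\<close>
  also have "\<dots> = (\<Sum>i = 0..<?n. \<Sum>j = 0..<?n. a i j * ((x $ j)\<^sup>2 + x $ i * x $ j))"
    by (subst sum.swap) (simp add: sym mult.commute)
  finally have 2: "x \<bullet> (signless_laplacian G vs *\<^sub>v x) =
    (\<Sum>i = 0..<?n. \<Sum>j = 0..<?n. a i j * ((x $ j)\<^sup>2 + x $ i * x $ j))" .
  have "2 * (x \<bullet> (signless_laplacian G vs *\<^sub>v x)) =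
      (\<Sum>i = 0..<?n. \<Sum>j = 0..<?n. a i j * ((x $ i)\<^sup>2 + x $ i * x $ j)) +
      (\<Sum>i = 0..<?n. \<Sum>j = 0..<?n. a i j * ((x $ j)\<^sup>2 + x $ i * x $ j))"
    using 1 2 by linarith
  also have "\<dots> = (\<Sum>i = 0..<?n. \<Sum>j = 0..<?n. a i j * (x $ i + x $ j)\<^sup>2)"
    unfolding sum.distrib[symmetric] by (intro sum.cong refl) (simp add: power2_sum algebra_simps)
  also have "\<dots> \<ge> 0" by (intro sum_nonneg mult_nonneg_nonneg) (auto simp: a_def)
  finally show ?thesis by simp
qed

text \<open>For an eigenvector \<open>x\<close> the nonnegative quadratic form equals
  \<open>m * (x \<bullet> x)\<close>, and \<open>x \<bullet> x > 0\<close>.\<close>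

lemma (in graph) main_eigenvalue_signless_laplacian_ge_0:
  assumes "vertex_enum G vs" "main_eigenvalue (signless_laplacian G vs) m"
  shows "0 \<le> m"
proof -
  obtain x where x: "x \<in> carrier_vec (length vs)" "signless_laplacian G vs *\<^sub>v x = m \<cdot>\<^sub>v x"
    and 0: "x \<bullet> all_ones (length vs) \<noteq> 0"
    using assms main_eigenvalue_iff[OF signless_laplacian_carrier] by blast
  have "x \<bullet> x \<noteq> 0" using 0 scalar_prod_self_eq_0[OF x(1)] by auto
  then have "0 < x \<bullet> x" using scalar_prod_self_ge_0[of x] by simp
  moreover have "0 \<le> m * (x \<bullet> x)" using signless_laplacian_psd[OF assms(1) x(1)] x by simp
  ultimately show ?thesis by (simp add: zero_le_mult_iff)
qed

section \<open>Iterates of the all-ones vector\<close>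

text \<open>The matrix and the all-ones vector have integer entries. This supplies the integral
  sequence for \<open>linear_recurrence_integral\<close>.\<close>

lemma Ints_signless_laplacian_iterate:
  assumes "i < length vs"
  shows "(((*\<^sub>v) (signless_laplacian G vs) ^^ k) (all_ones (length vs))) $ i \<in> \<int>"
  using assms
proof (induction k arbitrary: i)
  case 0
  then show ?case by (simp add: all_ones_def)
next
  case (Suc k)
  let ?x = "((*\<^sub>v) (signless_laplacian G vs) ^^ k) (all_ones (length vs))"
  have "?x \<in> carrier_vec (length vs)"
    by (cases k) (auto intro: mult_mat_vec_carrier carrier_vecI)
  then show ?case using Suc
    by (auto simp: index_signless_laplacian_mult_vec simp del: index_mult_mat_vec
        intro!: Ints_add Ints_mult Ints_sum)
qed

text \<open>Apply \<open>A\<close> repeatedly to the relation. Each coordinate of the iterates thus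
  satisfies one and the same second-order recurrence.\<close>

lemma iterate_quadratic_relation:
  fixes A :: "'a :: field mat"
  assumes A: "A \<in> carrier_mat n n" and x: "x \<in> carrier_vec n"
    and rel: "A *\<^sub>v (A *\<^sub>v x) = a \<cdot>\<^sub>v (A *\<^sub>v x) - b \<cdot>\<^sub>v x"
  shows "((*\<^sub>v) A ^^ (k + 2)) x = a \<cdot>\<^sub>v ((*\<^sub>v) A ^^ (k + 1)) x - b \<cdot>\<^sub>v ((*\<^sub>v) A ^^ k) x"
proof (induction k)
  case 0
  then show ?case using rel by (simp add: numeral_2_eq_2)
next
  case (Suc k)
  have c: "((*\<^sub>v) A ^^ m) x \<in> carrier_vec n" for m
    using A x by (induction m) auto
  have "((*\<^sub>v) A ^^ (Suc k + 2)) x = A *\<^sub>v ((*\<^sub>v) A ^^ (k + 2)) x" by simp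
  also have "\<dots> = A *\<^sub>v (a \<cdot>\<^sub>v ((*\<^sub>v) A ^^ (k + 1)) x - b \<cdot>\<^sub>v ((*\<^sub>v) A ^^ k) x)"
    unfolding Suc ..
  also have "\<dots> = a \<cdot>\<^sub>v (A *\<^sub>v ((*\<^sub>v) A ^^ (k + 1)) x) - b \<cdot>\<^sub>v (A *\<^sub>v ((*\<^sub>v) A ^^ k) x)"
    using A c[of k] c[of "k + 1"]
    by (simp add: mult_minus_distrib_mat_vec[of A n n] mult_mat_vec[of A n n] del: funpow.simps)
  finally show ?case by simp
qed

section \<open>Parabolic relation, regularity and uniqueness\<close>

text \<open>Compare entries, using \<open>M e = 2 d\<close> and
  \<open>M (M e) = 2 (d^2 + s)\<close>. Here \<open>a\<close> and \<open>b\<close> are real, and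
  \<open>b\<close> is twice the constant of the parabola.\<close>

lemma (in graph) quadratic_relation_iff:
  assumes vs: "vertex_enum G vs"
  defines "M \<equiv> signless_laplacian G vs" and "e \<equiv> all_ones (length vs)"
  shows "M *\<^sub>v (M *\<^sub>v e) = a \<cdot>\<^sub>v (M *\<^sub>v e) - b \<cdot>\<^sub>v e \<longleftrightarrow>
    (\<forall>v\<in>verts G. 2 * real (neighbour_degree_sum G v) =
      - 2 * (real (out_degree G v))\<^sup>2 + 2 * a * real (out_degree G v) - b)"
proof -
  have "M *\<^sub>v (M *\<^sub>v e) = a \<cdot>\<^sub>v (M *\<^sub>v e) - b \<cdot>\<^sub>v e \<longleftrightarrow>
      (\<forall>i<length vs. 2 * real (neighbour_degree_sum G (vs ! i)) =
        - 2 * (real (out_degree G (vs ! i)))\<^sup>2 + 2 * a * real (out_degree G (vs ! i)) - b)"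
    unfolding M_def e_def signless_laplacian_all_ones(2)[OF vs]
    unfolding signless_laplacian_all_ones(1)[OF vs]
    by (simp add: vec_eq_iff all_ones_def algebra_simps)
  also have "\<dots> \<longleftrightarrow> (\<forall>v\<in>set vs. 2 * real (neighbour_degree_sum G v) =
      - 2 * (real (out_degree G v))\<^sup>2 + 2 * a * real (out_degree G v) - b)"
    by (simp add: all_set_conv_all_nth)
  finally show ?thesis using vs by (simp add: vertex_enum_def)
qed

lemma (in graph) all_ones_eigenvector_iff_regular:
  assumes vs: "vertex_enum G vs"
  shows "signless_laplacian G vs *\<^sub>v all_ones (length vs) = c \<cdot>\<^sub>v all_ones (length vs) \<longleftrightarrow>
    (\<forall>v\<in>verts G. 2 * real (out_degree G v) = c)"
proof -
  have "signless_laplacian G vs *\<^sub>v all_ones (length vs) = c \<cdot>\<^sub>v all_ones (length vs) \<longleftrightarrow>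
    (\<forall>v\<in>set vs. 2 * real (out_degree G v) = c)"
    unfolding signless_laplacian_all_ones[OF vs]
    by (auto simp: vec_eq_iff all_ones_def all_set_conv_all_nth)
  then show ?thesis using vs by (simp add: vertex_enum_def)
qed

text \<open>Here \<open>s = d^2\<close>, so every slope \<open>a'\<close> fits with constant
  \<open>a' d - 2 d^2\<close>. The discriminant is then the square \<open>(a' - 4 d)^2\<close>, and
  all \<open>a' > 4 d\<close> are admissible.\<close>

lemma (in graph) regular_not_two_walk_parabolic:
  assumes reg: "\<And>v. v \<in> verts G \<Longrightarrow> out_degree G v = d"
  shows "\<not> two_walk_parabolic G a b"
proof
  assume par: "two_walk_parabolic G a b"
  have "neighbour_degree_sum G v = d * d" if "v \<in> verts G" for v
  proof -
    have "neighbour_degree_sum G v = (\<Sum>u | v \<rightarrow>\<^bsub>G\<^esub> u. d)"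
      unfolding neighbour_degree_sum_def using reg adj_in_verts(2) by (intro sum.cong) auto
    then show ?thesis using card_neighbours reg[OF that] by simp
  qed
  then have sum: "int (neighbour_degree_sum G v) =
      - (int (out_degree G v))\<^sup>2 + a' * int (out_degree G v) - (a' * int d - 2 * (int d)\<^sup>2)"
    if "v \<in> verts G" for v a'
    using that reg by (simp add: power2_eq_square)
  have "parabolic_pair G a' (a' * int d - 2 * (int d)\<^sup>2)" if a': "a' > 4 * int d" for a'
  proof -
    have "2 * int d * int d \<le> a' * int d" using a' by (intro mult_right_mono) auto
    moreover have "a'\<^sup>2 - 8 * (a' * int d - 2 * (int d)\<^sup>2) = (a' - 4 * int d)\<^sup>2"
      by (simp add: power2_eq_square algebra_simps)
    moreover have "0 < (a' - 4 * int d)\<^sup>2" using a' by simp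
    ultimately show ?thesis
      unfolding parabolic_pair_def using a' sum by (simp add: power2_eq_square)
  qed
  \<comment> \<open>Two admissible slopes contradict uniqueness.\<close>
  then have "4 * int d + 1 = a" "4 * int d + 2 = a"
    using par unfolding two_walk_parabolic_def by (meson less_add_one zless_add1_eq zero_less_numeral less_add_same_cancel1)+
  then show False by simp
qed

text \<open>Uniqueness of the parabola only says that two different degrees occur.\<close>

lemma (in graph) two_walk_parabolic_iff:
  "two_walk_parabolic G a b \<longleftrightarrow>
    parabolic_pair G a b \<and> (\<exists>u\<in>verts G. \<exists>v\<in>verts G. out_degree G u \<noteq> out_degree G v)"
proof
  assume *: "two_walk_parabolic G a b"
  have "\<exists>u\<in>verts G. \<exists>v\<in>verts G. out_degree G u \<noteq> out_degree G v"
  proof (rule ccontr)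
    assume "\<not> ?thesis"
    then have "\<exists>d. \<forall>v\<in>verts G. out_degree G v = d" by blast
    then show False using * regular_not_two_walk_parabolic by blast
  qed
  with * show "parabolic_pair G a b \<and> (\<exists>u\<in>verts G. \<exists>v\<in>verts G. out_degree G u \<noteq> out_degree G v)"
    by (simp add: two_walk_parabolic_def)
next
  assume "parabolic_pair G a b \<and> (\<exists>u\<in>verts G. \<exists>v\<in>verts G. out_degree G u \<noteq> out_degree G v)"
  then obtain u v where par: "parabolic_pair G a b" and uv: "u \<in> verts G" "v \<in> verts G"
    and ne: "out_degree G u \<noteq> out_degree G v" by blast
  have "a' = a \<and> b' = b" if par': "parabolic_pair G a' b'" for a' b'
  proof -
    \<comment> \<open>Subtracting the two parabolas leaves a relation linear in the degree; two
      distinct degrees force slope zero.\<close>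
    have "(a' - a) * int (out_degree G w) = b' - b" if "w \<in> verts G" for w
      using par par' that unfolding parabolic_pair_def by (auto simp: algebra_simps)
    note * = this[OF uv(1)] this[OF uv(2)]
    then have "(a' - a) * (int (out_degree G u) - int (out_degree G v)) = 0"
      by (simp add: right_diff_distrib)
    then have "a' = a" using ne by simp
    with * show ?thesis by simp
  qed
  with par show "two_walk_parabolic G a b" unfolding two_walk_parabolic_def by blast
qed

section \<open>The two implications\<close>

lemma (in graph) two_walk_parabolic_of_two_main_eigenvalues:
  assumes vs: "vertex_enum G vs"
    and main: "{m. main_eigenvalue (signless_laplacian G vs) m} = {p, q}" and "p \<noteq> q"
  shows "\<exists>a b. two_walk_parabolic G a b"
proof -
  let ?M = "signless_laplacian G vs" and ?e = "all_ones (length vs)"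
  note M = signless_laplacian_carrier[of G vs] transpose_signless_laplacian[of vs]
  have rel: "?M *\<^sub>v (?M *\<^sub>v ?e) = (p + q) \<cdot>\<^sub>v (?M *\<^sub>v ?e) - (p * q) \<cdot>\<^sub>v ?e"
    by (rule quadratic_relation_of_main_eigenvalues[OF M main])
  have s: "2 * real (neighbour_degree_sum G v) =
      - 2 * (real (out_degree G v))\<^sup>2 + 2 * (p + q) * real (out_degree G v) - p * q"
    if "v \<in> verts G" for v
    using quadratic_relation_iff[OF vs] rel that by blast
  have noneig: "?M *\<^sub>v ?e \<noteq> c \<cdot>\<^sub>v ?e" for c
    using main_eigenvalue_unique[OF M, of c] main \<open>p \<noteq> q\<close> by blast
  have "\<exists>u\<in>verts G. \<exists>v\<in>verts G. out_degree G u \<noteq> out_degree G v"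
  proof (rule ccontr)
    assume "\<not> ?thesis"
    then obtain d where "\<forall>v\<in>verts G. out_degree G v = d" by blast
    then show False using noneig[of "2 * real d"] all_ones_eigenvector_iff_regular[OF vs] by simp
  qed
  then obtain u v where uv: "u \<in> verts G" "v \<in> verts G" and ne: "out_degree G u \<noteq> out_degree G v"
    by blast
  obtain i j where ij: "i < length vs" "j < length vs" "vs ! i = u" "vs ! j = v"
    using uv vs unfolding vertex_enum_def by (metis in_set_conv_nth)
  define X where "X k = ((*\<^sub>v) ?M ^^ k) ?e" for k
  have Xc: "X k \<in> carrier_vec (length vs)" for k
    unfolding X_def by (cases k) (auto intro: carrier_vecI)
  have "X (k + 2) = (p + q) \<cdot>\<^sub>v X (k + 1) - (p * q) \<cdot>\<^sub>v X k" for k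
    unfolding X_def by (rule iterate_quadratic_relation[OF M(1) _ rel]) simp
  then have Xrec: "X (k + 2) $ l = (p + q) * X (k + 1) $ l - p * q * X k $ l" if "l < length vs" for k l
    using that Xc[of k] Xc[of "k + 1"] by simp
  \<comment> \<open>Taking the difference of two coordinates makes the sequence start at 0; its next
    term is twice the difference of the degrees of \<open>u\<close> and \<open>v\<close>, hence
    nonzero.\<close>
  have "p + q \<in> \<int>"
  proof (rule linear_recurrence_integral[where D = "\<lambda>k. X k $ i - X k $ j"])
    show "X k $ i - X k $ j \<in> \<int>" for k
      unfolding X_def using ij by (intro Ints_diff Ints_signless_laplacian_iterate)
    show "X 0 $ i - X 0 $ j = 0" using ij by (simp add: X_def all_ones_def)
    show "X 1 $ i - X 1 $ j \<noteq> 0"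
      using ij ne by (simp add: X_def signless_laplacian_all_ones(1)[OF vs])
    show "X (k + 2) $ i - X (k + 2) $ j =
        (p + q) * (X (k + 1) $ i - X (k + 1) $ j) - p * q * (X k $ i - X k $ j)" for k
      using Xrec ij by (simp add: algebra_simps)
    \<comment> \<open>The relation at \<open>u\<close> solved for \<open>p * q\<close>; it bounds
      the denominator of \<open>p * q\<close> by that of \<open>p + q\<close>.\<close>
    show "p * q = of_int (2 * int (out_degree G u)) * (p + q) -
        of_int (2 * int (neighbour_degree_sum G u) + 2 * (int (out_degree G u))\<^sup>2)"
      using s[OF uv(1)] by simp
  qed
  then obtain a where a: "p + q = of_int a" by (auto elim: Ints_cases)
  \<comment> \<open>The parabola at \<open>u\<close> solved for its constant term, so that
    integrality is evident.\<close>
  define b where "b = a * int (out_degree G u) - (int (out_degree G u))\<^sup>2 - int (neighbour_degree_sum G u)"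
  have b: "p * q = of_int (2 * b)" using s[OF uv(1)] by (simp add: b_def a)
  have ge: "0 \<le> p" "0 \<le> q" using main main_eigenvalue_signless_laplacian_ge_0[OF vs] by blast+
  have "parabolic_pair G a b"
    unfolding parabolic_pair_def
  proof (intro conjI ballI)
    have "0 < p + q" using ge \<open>p \<noteq> q\<close> by linarith
    then show "0 < a" by (simp add: a)
    have "0 \<le> p * q" using ge by simp
    then show "0 \<le> b" by (simp add: b)
    \<comment> \<open>Since \<open>p * q = 2 b\<close>, the left side is \<open>a^2 - 8 b\<close>;
      it is positive because \<open>p \<noteq> q\<close>.\<close>
    have "(p + q)\<^sup>2 - 4 * (p * q) = (p - q)\<^sup>2" by (simp add: power2_eq_square algebra_simps)
    moreover have "0 < (p - q)\<^sup>2" using \<open>p \<noteq> q\<close> by simp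
    ultimately have "(0 :: real) < of_int (a\<^sup>2 - 8 * b)" by (simp add: a b)
    then show "0 < a\<^sup>2 - 8 * b" by (simp only: of_int_0_less_iff)
    fix w assume "w \<in> verts G"
    from s[OF this]
    have "real_of_int (int (neighbour_degree_sum G w)) =
        of_int (- (int (out_degree G w))\<^sup>2 + a * int (out_degree G w) - b)"
      by (simp add: a b)
    then show "int (neighbour_degree_sum G w) = - (int (out_degree G w))\<^sup>2 + a * int (out_degree G w) - b"
      by (simp only: of_int_eq_iff)
  qed
  then show ?thesis using two_walk_parabolic_iff uv ne by blast
qed

text \<open>The main eigenvalues are the roots of \<open>t^2 - a t + 2 b\<close>, which are real and
  distinct because \<open>a^2 - 8 b > 0\<close>.\<close>

lemma (in graph) main_eigenvalues_of_two_walk_parabolic: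
  assumes vs: "vertex_enum G vs" and par: "two_walk_parabolic G a b"
  shows "card {m. main_eigenvalue (signless_laplacian G vs) m} = 2"
proof -
  let ?M = "signless_laplacian G vs" and ?e = "all_ones (length vs)"
  note M = signless_laplacian_carrier[of G vs] transpose_signless_laplacian[of vs]
  define r where "r = sqrt (of_int (a\<^sup>2 - 8 * b))"
  have pair: "parabolic_pair G a b" using par by (simp add: two_walk_parabolic_def)
  then have disc: "a\<^sup>2 - 8 * b > 0" by (simp add: parabolic_pair_def)
  then have r: "r > 0" "r\<^sup>2 = of_int (a\<^sup>2 - 8 * b)" unfolding r_def by (auto simp del: of_int_diff)
  define p q where "p = (of_int a + r) / 2" and "q = (of_int a - r) / 2"
  have "p * q = ((of_int a)\<^sup>2 - r\<^sup>2) / 4"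
    unfolding p_def q_def by (simp add: power2_eq_square algebra_simps)
  then have pq: "p + q = of_int a" "p * q = of_int (2 * b)" "p \<noteq> q"
    using r by (auto simp: p_def q_def field_simps)
  have "?M *\<^sub>v (?M *\<^sub>v ?e) = (p + q) \<cdot>\<^sub>v (?M *\<^sub>v ?e) - (p * q) \<cdot>\<^sub>v ?e"
    unfolding quadratic_relation_iff[OF vs] pq
  proof
    fix v assume "v \<in> verts G"
    then have "int (neighbour_degree_sum G v) = - (int (out_degree G v))\<^sup>2 + a * int (out_degree G v) - b"
      using pair by (simp add: parabolic_pair_def)
    then have "real_of_int (int (neighbour_degree_sum G v)) =
        of_int (- (int (out_degree G v))\<^sup>2 + a * int (out_degree G v) - b)"
      by (simp only:)
    then show "2 * real (neighbour_degree_sum G v) =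
        - 2 * (real (out_degree G v))\<^sup>2 + 2 * of_int a * real (out_degree G v) - of_int (2 * b)"
      by simp
  qed
  \<comment> \<open>An eigenvector equation for the all-ones vector would make all degrees equal,
    against the two different degrees that uniqueness provides.\<close>
  moreover have "?M *\<^sub>v ?e \<noteq> c \<cdot>\<^sub>v ?e" for c
    using par unfolding two_walk_parabolic_iff all_ones_eigenvector_iff_regular[OF vs]
    by (metis of_nat_eq_iff mult_cancel_left zero_neq_numeral)
  ultimately have "{m. main_eigenvalue ?M m} = {p, q}"
    by (rule main_eigenvalues_of_quadratic_relation[OF M])
  then show ?thesis using pq by simp
qed

theorem theorem6:
  fixes G :: "('a, 'b) pre_digraph" and vs :: "'a list"
  assumes "graph G" and "Digraph_Component.connected G" and "vertex_enum G vs"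
  shows "card {\<mu>. main_eigenvalue (signless_laplacian G vs) \<mu>} = 2 \<longleftrightarrow>
           (\<exists>a b. two_walk_parabolic G a b)"
proof
  assume "card {\<mu>. main_eigenvalue (signless_laplacian G vs) \<mu>} = 2"
  then obtain p q where "{\<mu>. main_eigenvalue (signless_laplacian G vs) \<mu>} = {p, q}" "p \<noteq> q"
    unfolding card_2_iff by blast
  then show "\<exists>a b. two_walk_parabolic G a b"
    by (rule graph.two_walk_parabolic_of_two_main_eigenvalues[OF assms(1,3)])
next
  assume "\<exists>a b. two_walk_parabolic G a b"
  then show "card {\<mu>. main_eigenvalue (signless_laplacian G vs) \<mu>} = 2"
    using graph.main_eigenvalues_of_two_walk_parabolic[OF assms(1,3)] by blast
qed

end
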